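(* Let $q \geq 2$ and let $n, r$ be positive integers with $r \leq n-1$. Let $Q_{n,q}$ be the probability measure on partitions $\lambda$ of $n$ given by \[ Q_{n,q}(\lambda) = \frac{1}{z(n,q)} \cdot \frac{1}{q^{|\lambda|+2n(\lambda)} \prod_{s \in \lambda} (1-q^{-h(s)})^2}, \] where $z(n,q)$ is the coefficient of $u^n$ in $\prod_{i=1}^{\infty}\prod_{j=0}^{\infty} \frac{1}{1-u/q^{i+j}}$, and let $Q_{n,q}^r$ be the $Q_{n,q}$-probability that $\lambda_1 < r$. Then \begin{enumerate} \item $Q_{n,q}^r \leq \frac{1}{(1-1/q)^{1+4\sqrt{2n}}} \left[\frac{1}{q^{2n-2r+2}} + \frac{1}{1-1/q^{2n+1}} \cdot \frac{1}{q^{n+1}}\right]$; \item $Q_{n,q}^r \geq (1-1/q^n)(1-1/q)^4 \left[\frac{1}{q^{2n-2r+2}} - \frac{1}{q^{n+1}(1-1/q)} - \frac{1}{q^{2n-2r+3}(1-1/q)^2} - \frac{1}{q^{3n-3r+4}(1-1/q)^3} - \frac{1}{(1-1/q)^2}\cdot\frac{1}{q^{2n+3}(1-1/q^{2n+3})}\right]$. \end{enumerate}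
   Context: For a partition $\lambda$ with parts $\lambda_1 \geq \lambda_2 \geq \cdots$: $\lambda_1$ is the largest part; $n(\lambda) = \sum_i (i-1)\lambda_i$; the diagram of $\lambda$ is the set of cells $(i,j)$ with $1 \leq j \leq \lambda_i$, and for a cell $s$ the hook length is $h(s) = a(s)+l(s)+1$, where $a(s)$ is the number of cells in the same row to the right of $s$ and $l(s)$ the number of cells in the same column below $s$. *)

theory Defs
  imports "HOL-Complex_Analysis.Complex_Analysis"
begin

(* A partition is the list of its positive parts in weakly decreasing order. *)
definition partitions :: "nat \<Rightarrow> nat list set" where
  "partitions n = {l. sorted_wrt (\<ge>) l \<and> (\<forall>x\<in>set l. 1 \<le> x) \<and> sum_list l = n}"

(* Parts, rows and columns are numbered from 1; parts beyond the last one are 0. *)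
definition part :: "nat list \<Rightarrow> nat \<Rightarrow> nat" where
  "part l i = (if 1 \<le> i \<and> i \<le> length l then l ! (i - 1) else 0)"

definition n_stat :: "nat list \<Rightarrow> nat" where
  "n_stat l = (\<Sum>i=1..length l. (i - 1) * part l i)"

definition diagram :: "nat list \<Rightarrow> (nat \<times> nat) set" where
  "diagram l = {(i, j). 1 \<le> i \<and> i \<le> length l \<and> 1 \<le> j \<and> j \<le> part l i}"

definition arm :: "nat list \<Rightarrow> nat \<times> nat \<Rightarrow> nat" where
  "arm l s = card {t \<in> diagram l. fst t = fst s \<and> snd t > snd s}"

definition leg :: "nat list \<Rightarrow> nat \<times> nat \<Rightarrow> nat" where
  "leg l s = card {t \<in> diagram l. snd t = snd s \<and> fst t > fst s}"

definition hook :: "nat list \<Rightarrow> nat \<times> nat \<Rightarrow> nat" where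
  "hook l s = arm l s + leg l s + 1"

(* The outer product starts at i = 1 in the mathematical notation, hence the Suc. *)
definition z_genfun :: "real \<Rightarrow> complex \<Rightarrow> complex" where
  "z_genfun q u = (\<Prod>i. \<Prod>j. 1 / (1 - u / of_real q ^ (Suc i + j)))"

(* The n-th Taylor coefficient at u = 0. It is a real number because q is real;
   the product is expanded over the complex numbers, where it is analytic near 0,
   since it does not converge in the topology of the type of formal power series. *)
definition z_coeff :: "nat \<Rightarrow> real \<Rightarrow> real" where
  "z_coeff n q = Re (fps_nth (fps_expansion (z_genfun q) 0) n)"

definition Q_mass :: "nat \<Rightarrow> real \<Rightarrow> nat list \<Rightarrow> real" where
  "Q_mass n q l = 1 / z_coeff n q *
     (1 / (q ^ (sum_list l + 2 * n_stat l) * (\<Prod>s\<in>diagram l. (1 - 1 / q ^ hook l s)\<^sup>2)))"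

definition Q_measure :: "nat \<Rightarrow> real \<Rightarrow> nat list measure" where
  "Q_measure n q = point_measure (partitions n) (\<lambda>l. ennreal (Q_mass n q l))"

definition Q_prob :: "nat \<Rightarrow> real \<Rightarrow> nat \<Rightarrow> real" where
  "Q_prob n q r = measure (Q_measure n q) {l \<in> space (Q_measure n q). part l 1 < r}"

end

(* Write x = 1/q. The product P(u) defining z(n,q) equals A(xu), where A is determined by
   A(u) = F(u) A(xu), A(0) = 1 and F(u) = \<Prod>j. 1/(1 - x^j u); so z(n,q) = x^n a(n) with an explicit
   recursion for the coefficients a(n) of A, and the normalised mass of l is
   x^(2 n(l)) / (a(n) \<Prod>s. (1 - x^h(s))^2).

   Upper bound: the hook product of each row is at least (1 - x)^2, so the mass is at most a row by
   row weight. Removing a first row of length c divides x^(2 n(l)) by x^(2(n - c)), so the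
   partitions with first row below r contribute essentially the first term of a geometric series
   starting at x^(2(n - r + 1)).

   Lower bound: unless 2r > n + 1 and x < (1 - x)^2 the bracket is not positive; otherwise the single
   two-row partition (r - 1, n - r + 1) already has enough mass, by an upper bound for a(n). *)
theory Submission
  imports Defs
begin

section \<open>Coefficients of the Euler product and of its iterated version: recursions and
  bounds\<close>

text \<open>The coefficient of \<open>u\<^sup>n\<close> in \<open>\<Prod>j. 1 / (1 - x\<^sup>j u)\<close> (Euler).\<close>

definition euler_coeff :: "real \<Rightarrow> nat \<Rightarrow> real" where
  "euler_coeff x n = 1 / (\<Prod>k=1..n. 1 - x ^ k)"

text \<open>The coefficient of \<open>u\<^sup>n\<close> in \<open>\<Prod>i. \<Prod>j. 1 / (1 - x\<^bsup>i + j\<^esup> u)\<close>,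
  with both indices starting at 0.\<close>

fun cauchy_coeff :: "real \<Rightarrow> nat \<Rightarrow> real" where
  "cauchy_coeff x n =
     (if n = 0 then 1
      else (\<Sum>m<n. euler_coeff x (n - m) * x ^ m * cauchy_coeff x m) / (1 - x ^ n))"

declare cauchy_coeff.simps [simp del]

lemma one_minus_power_pos:
  fixes x :: real
  assumes "0 < x" "x < 1" "n > 0"
  shows "0 < 1 - x ^ n"
  using assms by (simp add: power_less_one_iff)

text \<open>A truncation of Euler's pentagonal number series. The summand \<open>x ^ Suc n\<close>
  makes the induction close: multiplying by \<open>1 - x ^ Suc n\<close> overshoots the next bound
  by exactly \<open>x ^ (n + 3) - x ^ (2 * n + 2)\<close>.\<close>

lemma euler_prod_lower:
  fixes x :: real
  assumes "0 < x" "x < 1" "n > 0"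
  shows "1 - x - x\<^sup>2 + x ^ Suc n \<le> (\<Prod>k=1..n. 1 - x ^ k)"
  using \<open>n > 0\<close>
proof (induction n rule: nat_induct_non_zero)
  case 1
  then show ?case by (simp add: power2_eq_square)
next
  case (Suc n)
  have "x ^ (2 * n + 2) \<le> x ^ (n + 3)"
    using Suc assms by (intro power_decreasing) auto
  hence "1 - x - x\<^sup>2 + x ^ Suc (Suc n) \<le> (1 - x - x\<^sup>2 + x ^ Suc n) * (1 - x ^ Suc n)"
    by (simp add: algebra_simps power2_eq_square power_add power_mult eval_nat_numeral power_mult_distrib)
  also have "\<dots> \<le> (\<Prod>k=1..n. 1 - x ^ k) * (1 - x ^ Suc n)"
    using Suc assms one_minus_power_pos[of x "Suc n"] by (intro mult_right_mono) auto
  finally show ?case by simp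
qed

text \<open>For positive \<open>x\<close>, the condition \<open>x \<le> 1/2\<close> is equivalent to
  \<open>(1 - x)^2 \<le> 1 - x - x^2\<close>. This is where \<open>q \<ge> 2\<close> enters the
  estimates.\<close>

lemma euler_prod_ge:
  fixes x :: real
  assumes "0 < x" "x \<le> 1/2"
  shows "(1 - x)\<^sup>2 \<le> (\<Prod>k=1..n. 1 - x ^ k)"
proof (cases "n = 0")
  case True
  thus ?thesis using assms by (simp add: power_le_one)
next
  case False
  have "x * x \<le> 1/2 * x" using assms by (intro mult_right_mono) auto
  hence "(1 - x)\<^sup>2 \<le> 1 - x - x\<^sup>2"
    by (simp add: power2_eq_square algebra_simps)
  also have "\<dots> \<le> 1 - x - x\<^sup>2 + x ^ Suc n" using assms by simp
  also have "\<dots> \<le> (\<Prod>k=1..n. 1 - x ^ k)"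
    using False assms by (intro euler_prod_lower) auto
  finally show ?thesis .
qed

lemma euler_coeff_0 [simp]: "euler_coeff x 0 = 1"
  by (simp add: euler_coeff_def)

lemma euler_coeff_nonneg:
  assumes "0 < x" "x < 1"
  shows "0 \<le> euler_coeff x n"
proof -
  have "0 < (\<Prod>k=1..n. 1 - x ^ k)"
    using assms by (intro prod_pos) (auto intro: one_minus_power_pos[simplified])
  thus ?thesis by (simp add: euler_coeff_def)
qed

lemma euler_coeff_le:
  assumes "0 < x" "x \<le> 1/2"
  shows "euler_coeff x n \<le> 1 / (1 - x)\<^sup>2"
proof -
  have "0 < (\<Prod>k=1..n. 1 - x ^ k)"
    using assms by (intro prod_pos) (auto intro: one_minus_power_pos[simplified])
  thus ?thesis
    unfolding euler_coeff_def using assms euler_prod_ge[OF assms, of n]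
    by (intro divide_left_mono mult_pos_pos) auto
qed

lemma euler_coeff_ge:
  assumes "0 < x" "x < 1" "n > 0"
  shows "1 / (1 - x) \<le> euler_coeff x n"
proof -
  have pos: "0 < (\<Prod>k=1..n. 1 - x ^ k)"
    using assms by (intro prod_pos) (auto intro: one_minus_power_pos[simplified])
  have "(\<Prod>k=1..n. 1 - x ^ k) = (1 - x) * (\<Prod>k=2..n. 1 - x ^ k)"
    using assms by (subst prod.atLeast_Suc_atMost) (auto simp: numeral_2_eq_2)
  also have "\<dots> \<le> (1 - x) * 1"
    using assms
    by (intro mult_left_mono prod_le_1) (auto simp: power_le_one)
  finally show ?thesis
    unfolding euler_coeff_def using pos assms by (intro divide_left_mono) auto
qed

text \<open>Coefficient form of the functional equation (1 - u) F(u) = F(xu).\<close>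

lemma euler_coeff_rec:
  assumes "0 < x" "x < 1" "n > 0"
  shows "euler_coeff x n - euler_coeff x (n - 1) = euler_coeff x n * x ^ n"
proof -
  obtain k where n: "n = Suc k" using assms by (cases n) auto
  have "0 < (\<Prod>k=1..k. 1 - x ^ k)"
    using assms by (intro prod_pos) (auto intro: one_minus_power_pos[simplified])
  moreover have "0 < 1 - x ^ Suc k" using assms by (intro one_minus_power_pos) auto
  moreover have "1 / (p * (1 - t)) - 1 / p = 1 / (p * (1 - t)) * t" if "0 < p" "0 < 1 - t" for p t :: real
    using that by (simp add: field_simps)
  ultimately show ?thesis unfolding n euler_coeff_def by simp
qed

lemma cauchy_coeff_0 [simp]: "cauchy_coeff x 0 = 1"
  by (simp add: cauchy_coeff.simps)

lemma cauchy_coeff_rec: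
  assumes "0 < x" "x < 1" "n > 0"
  shows "(1 - x ^ n) * cauchy_coeff x n = (\<Sum>m<n. euler_coeff x (n - m) * x ^ m * cauchy_coeff x m)"
  using one_minus_power_pos[OF assms] assms by (subst cauchy_coeff.simps) simp

text \<open>Coefficient form of A(u) = F(u) A(xu): moving the term m = n to the left-hand side turns
  it into the defining recursion.\<close>

lemma cauchy_coeff_convolution:
  assumes "0 < x" "x < 1"
  shows "cauchy_coeff x n = (\<Sum>m\<le>n. euler_coeff x (n - m) * (x ^ m * cauchy_coeff x m))"
proof (cases "n = 0")
  case False
  have "{..n} = insert n {..<n}" by auto
  thus ?thesis using cauchy_coeff_rec[of x n] assms False by (simp add: algebra_simps)
qed simp

lemma cauchy_coeff_nonneg:
  assumes "0 < x" "x < 1"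
  shows "0 \<le> cauchy_coeff x n"
proof (induction n rule: less_induct)
  case (less n)
  show ?case
    using less assms
    by (subst cauchy_coeff.simps)
       (auto intro!: divide_nonneg_nonneg sum_nonneg mult_nonneg_nonneg euler_coeff_nonneg power_le_one)
qed

text \<open>The term m = 0 of the convolution alone suffices. The resulting factor
  \<open>1 - x\<close> in the mass later saves one power of \<open>1 - x\<close> in the upper
  bound.\<close>

lemma cauchy_coeff_ge:
  assumes "0 < x" "x < 1" "n > 0"
  shows "1 / (1 - x) \<le> cauchy_coeff x n"
proof -
  have "1 / (1 - x) \<le> euler_coeff x n"
    by (intro euler_coeff_ge assms)
  also have "\<dots> = (\<Sum>m\<in>{0}. euler_coeff x (n - m) * (x ^ m * cauchy_coeff x m))"
    by simp
  also have "\<dots> \<le> (\<Sum>m\<le>n. euler_coeff x (n - m) * (x ^ m * cauchy_coeff x m))"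
    using assms by (intro sum_mono2 mult_nonneg_nonneg euler_coeff_nonneg cauchy_coeff_nonneg) auto
  finally show ?thesis using cauchy_coeff_convolution[of x n] assms by simp
qed

lemma cauchy_coeff_pos:
  assumes "0 < x" "x < 1"
  shows "0 < cauchy_coeff x n"
proof (cases "n = 0")
  case False
  have "0 < 1 / (1 - x)" using assms by simp
  also have "\<dots> \<le> cauchy_coeff x n" using assms False by (intro cauchy_coeff_ge) auto
  finally show ?thesis .
qed simp

text \<open>A crude bound that serves only to give the power series A a positive radius of
  convergence.\<close>

lemma cauchy_coeff_le_exp:
  assumes "0 < x" "x \<le> 1/2"
  shows "cauchy_coeff x n \<le> 16 ^ n"
proof (induction n rule: less_induct)
  case (less n)
  show ?case
  proof (cases "n = 0")
    case False
    have e4: "euler_coeff x k \<le> 4" for k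
    proof -
      have "(1/2)\<^sup>2 \<le> (1 - x)\<^sup>2" using assms by (intro power_mono) auto
      hence "1 / (1 - x)\<^sup>2 \<le> 1 / (1/2)\<^sup>2"
        using assms by (intro divide_left_mono) auto
      thus ?thesis using euler_coeff_le[OF assms, of k] by (simp add: power2_eq_square)
    qed
    have "(\<Sum>m<n. euler_coeff x (n - m) * x ^ m * cauchy_coeff x m) \<le> (\<Sum>m<n. 4 * (1/2) ^ m * 16 ^ m)"
      using less assms
      by (intro sum_mono mult_mono e4 power_mono mult_nonneg_nonneg euler_coeff_nonneg cauchy_coeff_nonneg) auto
    also have "\<dots> = 4 * (\<Sum>m<n. 8 ^ m)"
      by (simp add: sum_distrib_left mult.assoc flip: power_mult_distrib)
    also have "\<dots> = 4 / 7 * (8 ^ n - 1)"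
      by (simp add: geometric_sum)
    finally have 1: "(1 - x ^ n) * cauchy_coeff x n \<le> 4 / 7 * (8 ^ n - 1)"
      using cauchy_coeff_rec[of x n] assms False by simp
    have "x ^ n \<le> x ^ 1" using assms False by (intro power_decreasing) auto
    hence "1/2 * cauchy_coeff x n \<le> (1 - x ^ n) * cauchy_coeff x n"
      using assms by (intro mult_right_mono cauchy_coeff_nonneg) auto
    with 1 have "cauchy_coeff x n \<le> 8 / 7 * (8 ^ n - 1)" by simp
    also have "\<dots> \<le> 2 * 8 ^ n"
      using zero_le_power[of "8::real" n] by (simp add: field_simps)
    also have "\<dots> \<le> 2 ^ n * 8 ^ n"
    proof -
      have "(2::real) ^ 1 \<le> 2 ^ n" using False by (intro power_increasing) auto
      thus ?thesis by (intro mult_right_mono) auto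
    qed
    also have "\<dots> = (16::real) ^ n" by (simp flip: power_mult_distrib)
    finally show ?thesis .
  qed simp
qed

lemma geometric_tail_le:
  fixes x :: real
  assumes "0 < x" "x < 1"
  shows "(\<Sum>i=a..<n. x ^ i) \<le> x ^ a / (1 - x)"
proof -
  have "(\<Sum>i=a..<n. x ^ i) = x ^ a * (\<Sum>i<n - a. x ^ i)"
    by (simp add: sum.atLeastLessThan_shift_0[of _ a n] power_add sum_distrib_left atLeast0LessThan)
  also have "\<dots> \<le> x ^ a * (1 / (1 - x))"
    using assms by (intro mult_left_mono less_imp_le[OF geometric_sum_less]) auto
  finally show ?thesis by simp
qed

text \<open>Strong induction on the recursion: every Euler coefficient is at most
  \<open>1 / (1 - x)^2\<close>, the terms m = 0 and m = 1 are evaluated exactly, and the others are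
  summed geometrically by the induction hypothesis.\<close>

lemma cauchy_coeff_upper:
  assumes "0 < x" "x \<le> 1/2" "x < (1 - x)\<^sup>2" "n > 0"
  shows "(1 - x ^ n) * cauchy_coeff x n * ((1 - x)\<^sup>2 * ((1 - x)\<^sup>2 - x)) \<le> 1"
proof -
  define w where "w = 1 - x"
  \<comment> \<open>The inverse of \<open>B\<close> is \<open>w^4 * (1 - x / w^2)\<close>, the
    factor that the stated lower bound produces from \<open>(1 - x) ^ 4\<close> and the first and
    third terms of its bracket.\<close>
  define B where "B = 1 / (w\<^sup>2 * (w\<^sup>2 - x))"
  have w: "0 < w" "w < 1" "x < w\<^sup>2" using assms by (auto simp: w_def)
  have B: "B > 0" using w by (simp add: B_def)
  have a1: "cauchy_coeff x 1 = 1 / w\<^sup>2"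
    using assms by (subst cauchy_coeff.simps) (simp add: euler_coeff_def w_def power2_eq_square)
  \<comment> \<open>The left-hand side will bound the sum of \<open>x ^ m * cauchy_coeff x m\<close>
    over m < n; the factor \<open>w^2\<close> on the right absorbs the bound on the Euler
    coefficients.\<close>
  have key: "1 + x / w\<^sup>2 + B * (x\<^sup>2 / (w * (1 - x\<^sup>2))) \<le> B * w\<^sup>2"
  proof -
    have "0 \<le> w * (w\<^sup>2 - x)" using w by simp
    also have "w * (w\<^sup>2 - x) = w\<^sup>2 * (1 + w) + x - 1"
      by (simp add: w_def power2_eq_square algebra_simps)
    finally have "x * 1 \<le> x * (w\<^sup>2 * (1 + w) + x)"
      using assms by (intro mult_left_mono) auto
    also have "\<dots> = w\<^sup>2 - w ^ 4 + x\<^sup>2"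
      by (simp add: w_def power2_eq_square eval_nat_numeral algebra_simps)
    finally have 1: "(w\<^sup>2 + x) * (w\<^sup>2 - x) + x \<le> w\<^sup>2"
      by (simp add: power2_eq_square eval_nat_numeral algebra_simps)
    have "x\<^sup>2 / (w * (1 - x\<^sup>2)) = x * (x / (w\<^sup>2 * (1 + x)))"
      by (simp add: w_def power2_eq_square field_simps)
    also have "x / (w\<^sup>2 * (1 + x)) \<le> 1"
    proof -
      have "w\<^sup>2 * 1 \<le> w\<^sup>2 * (1 + x)" using assms w by (intro mult_left_mono) auto
      hence "x \<le> w\<^sup>2 * (1 + x)" using w by linarith
      moreover have "0 < w\<^sup>2 * (1 + x)" using w assms by simp
      ultimately show ?thesis by (subst divide_le_eq_1_pos)
    qed
    hence "x * (x / (w\<^sup>2 * (1 + x))) \<le> x * 1"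
      using assms by (intro mult_left_mono) auto
    finally have 2: "x\<^sup>2 / (w * (1 - x\<^sup>2)) \<le> x" by simp
    have "1 + x / w\<^sup>2 = (w\<^sup>2 + x) * (1 / w\<^sup>2)"
      using w by (simp add: field_simps)
    also have "1 / w\<^sup>2 = B * (w\<^sup>2 - x)"
      using w by (simp add: B_def)
    finally have "1 + x / w\<^sup>2 = B * ((w\<^sup>2 + x) * (w\<^sup>2 - x))"
      by (simp only: mult_ac)
    hence "1 + x / w\<^sup>2 + B * (x\<^sup>2 / (w * (1 - x\<^sup>2))) = B * ((w\<^sup>2 + x) * (w\<^sup>2 - x) + x\<^sup>2 / (w * (1 - x\<^sup>2)))"
      by (simp add: algebra_simps)
    also have "\<dots> \<le> B * w\<^sup>2"
      using 1 2 B by (intro mult_left_mono) auto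
    finally show ?thesis .
  qed
  have "(1 - x ^ n) * cauchy_coeff x n \<le> B"
    using \<open>n > 0\<close>
  proof (induction n rule: less_induct)
    case (less n)
    have "(1 - x ^ n) * cauchy_coeff x n = (\<Sum>m<n. euler_coeff x (n - m) * (x ^ m * cauchy_coeff x m))"
      using cauchy_coeff_rec[of x n] assms less by (simp add: mult.assoc)
    also have "\<dots> \<le> (\<Sum>m<n. 1 / w\<^sup>2 * (x ^ m * cauchy_coeff x m))"
      unfolding w_def using assms
      by (intro sum_mono mult_right_mono euler_coeff_le mult_nonneg_nonneg cauchy_coeff_nonneg) auto
    also have "\<dots> = 1 / w\<^sup>2 * (\<Sum>m<n. x ^ m * cauchy_coeff x m)"
      by (simp add: sum_distrib_left)
    \<comment> \<open>The larger index set treats n = 1 like the other cases; it only adds a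
      nonnegative term.\<close>
    also have "(\<Sum>m<n. x ^ m * cauchy_coeff x m) \<le> (\<Sum>m\<in>{0,1} \<union> {2..<n}. x ^ m * cauchy_coeff x m)"
      using assms by (intro sum_mono2 mult_nonneg_nonneg cauchy_coeff_nonneg) auto
    also have "\<dots> = 1 + x / w\<^sup>2 + (\<Sum>m=2..<n. x ^ m * cauchy_coeff x m)"
      by (subst sum.union_disjoint) (auto simp: a1[simplified])
    also have "(\<Sum>m=2..<n. x ^ m * cauchy_coeff x m) \<le> (\<Sum>m=2..<n. B / (1 - x\<^sup>2) * x ^ m)"
    proof (intro sum_mono)
      fix m assume m: "m \<in> {2..<n}"
      have p2: "0 < 1 - x\<^sup>2" using assms by (intro one_minus_power_pos) auto
      have "x ^ m \<le> x\<^sup>2" using assms m by (intro power_decreasing) auto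
      hence "(1 - x\<^sup>2) * cauchy_coeff x m \<le> (1 - x ^ m) * cauchy_coeff x m"
        using assms by (intro mult_right_mono cauchy_coeff_nonneg) auto
      also have "\<dots> \<le> B" using less m by auto
      finally have "cauchy_coeff x m \<le> B / (1 - x\<^sup>2)" using p2 by (simp add: field_simps)
      thus "x ^ m * cauchy_coeff x m \<le> B / (1 - x\<^sup>2) * x ^ m"
        using assms mult_right_mono[of "cauchy_coeff x m" "B / (1 - x\<^sup>2)" "x ^ m"]
        by (simp add: mult.commute)
    qed
    also have "\<dots> = B / (1 - x\<^sup>2) * (\<Sum>m=2..<n. x ^ m)" by (simp add: sum_distrib_left)
    also have "\<dots> \<le> B / (1 - x\<^sup>2) * (x\<^sup>2 / w)"
    proof (intro mult_left_mono)
      show "(\<Sum>m=2..<n. x ^ m) \<le> x\<^sup>2 / w"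
        unfolding w_def using assms by (intro geometric_tail_le) auto
      show "0 \<le> B / (1 - x\<^sup>2)" using B assms one_minus_power_pos[of x 2] by simp
    qed
    also have "1 + x / w\<^sup>2 + B / (1 - x\<^sup>2) * (x\<^sup>2 / w) = 1 + x / w\<^sup>2 + B * (x\<^sup>2 / (w * (1 - x\<^sup>2)))"
      by (simp add: mult.commute)
    also have "\<dots> \<le> B * w\<^sup>2" by (rule key)
    finally show ?case using w by (simp add: divide_right_mono)
  qed
  hence "(1 - x ^ n) * cauchy_coeff x n * (w\<^sup>2 * (w\<^sup>2 - x)) \<le> B * (w\<^sup>2 * (w\<^sup>2 - x))"
    using w by (intro mult_right_mono) auto
  also have "\<dots> = 1" using w by (simp add: B_def)
  finally show ?thesis by (simp add: w_def)
qed

section \<open>The normalising constant\<close>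

text \<open>Iterating \<open>P v = \<phi> v * P (v * x)\<close> leaves the factor \<open>P (u * x\<^sup>N)\<close>, which tends to \<open>P 0\<close>.\<close>

lemma prodinf_dilation:
  fixes P \<phi> :: "complex \<Rightarrow> complex" and x :: complex
  assumes x: "norm x < 1" and cont: "isCont P 0" and P0: "P 0 = 1"
    and feq: "\<And>v. norm v \<le> norm u \<Longrightarrow> P v = \<phi> v * P (v * x)" and nz: "P u \<noteq> 0"
  shows "(\<Prod>i. \<phi> (u * x ^ i)) = P u"
proof -
  have part: "(\<Prod>i\<le>N. \<phi> (u * x ^ i)) * P (u * x ^ Suc N) = P u" for N
  proof (induction N)
    case 0
    show ?case using feq[of u] by simp
  next
    case (Suc N)
    have "norm (u * x ^ Suc N) \<le> norm u * 1"
      unfolding norm_mult norm_power using x by (intro mult_left_mono power_le_one) auto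
    from feq[of "u * x ^ Suc N"] this Suc show ?case by (simp add: mult_ac)
  qed
  have "(\<lambda>N. u * x ^ Suc N) \<longlonglongrightarrow> u * 0"
    by (intro tendsto_intros LIMSEQ_Suc LIMSEQ_power_zero x)
  hence "(\<lambda>N. P (u * x ^ Suc N)) \<longlonglongrightarrow> 1"
    using isCont_tendsto_compose[OF cont, of "\<lambda>N. u * x ^ Suc N"] P0 by simp
  hence "(\<lambda>N. P u / P (u * x ^ Suc N)) \<longlonglongrightarrow> P u / 1"
    by (intro tendsto_intros) auto
  also have "(\<lambda>N. P u / P (u * x ^ Suc N)) = (\<lambda>N. \<Prod>i\<le>N. \<phi> (u * x ^ i))"
  proof
    fix N
    have "P (u * x ^ Suc N) \<noteq> 0" using part[of N] nz by auto
    thus "P u / P (u * x ^ Suc N) = (\<Prod>i\<le>N. \<phi> (u * x ^ i))"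
      using part[of N] by (simp add: field_simps)
  qed
  \<comment> \<open>Convergence of an infinite product includes that the limit is nonzero, hence the
    assumption \<open>nz\<close>.\<close>
  finally have "raw_has_prod (\<lambda>i. \<phi> (u * x ^ i)) 0 (P u)"
    using nz by (simp add: raw_has_prod_def)
  thus ?thesis by (metis has_prod_def has_prod_unique)
qed

lemma fps_conv_radius_ge_of_exp_bound:
  fixes a :: "nat \<Rightarrow> real"
  assumes "\<And>n. 0 \<le> a n" "\<And>n. a n \<le> C * K ^ n" "K > 0"
  shows "fps_conv_radius (Abs_fps (\<lambda>n. complex_of_real (a n))) \<ge> 1 / K"
  unfolding fps_conv_radius_def
proof (rule conv_radius_geI_ex')
  fix r :: real assume r: "0 < r" "ereal r < 1 / K"
  hence "K * r < 1" using assms(3) by (simp add: field_simps)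
  have "summable (\<lambda>n. C * (K * r) ^ n)"
    using r assms(3) \<open>K * r < 1\<close> by (intro summable_mult summable_geometric) auto
  hence "summable (\<lambda>n. complex_of_real (a n) * of_real r ^ n)"
  proof (rule summable_comparison_test'[where N = 0])
    fix n
    show "norm (complex_of_real (a n) * of_real r ^ n) \<le> C * (K * r) ^ n"
      using assms(1)[of n] mult_right_mono[OF assms(2)[of n], of "r ^ n"] r
      by (simp add: norm_mult norm_power power_mult_distrib mult_ac)
  qed
  thus "summable (\<lambda>n. fps_nth (Abs_fps (\<lambda>n. complex_of_real (a n))) n * of_real r ^ n)"
    by simp
qed

lemma eval_fps_dilation:
  "eval_fps (Abs_fps (\<lambda>n. f n * c ^ n)) u = eval_fps (Abs_fps f) (u * c :: complex)"
  by (simp add: eval_fps_def power_mult_distrib mult_ac)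

lemma fps_conv_radius_dilation:
  assumes "norm (c :: complex) \<le> 1"
  shows "fps_conv_radius (Abs_fps f) \<le> fps_conv_radius (Abs_fps (\<lambda>n. f n * c ^ n))"
  unfolding fps_conv_radius_def
proof (rule conv_radius_geI_ex')
  fix r :: real assume r: "0 < r" "ereal r < conv_radius (fps_nth (Abs_fps f))"
  have "norm (of_real r * c) \<le> r * 1"
    unfolding norm_mult using r assms by (intro mult_mono) auto
  with r have "ereal (norm (of_real r * c)) < conv_radius (fps_nth (Abs_fps f))"
    using le_less_trans ereal_less_eq(3) by (metis mult.right_neutral)
  from summable_in_conv_radius[OF this]
  show "summable (\<lambda>n. fps_nth (Abs_fps (\<lambda>n. f n * c ^ n)) n * of_real r ^ n)"
    by (simp add: power_mult_distrib mult_ac)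
qed

text \<open>\<open>prodinf_dilation\<close> is applied twice, to F for the inner product and to A
  for the outer one. As the outer index starts at 1, the result is A(xu), and uniqueness of the
  power series expansion at 0 gives the coefficient.\<close>

lemma z_coeff_eq:
  assumes "q \<ge> 2"
  shows "z_coeff n q = cauchy_coeff (1 / q) n * (1 / q) ^ n"
proof -
  define x where "x = 1 / q"
  define X where "X = complex_of_real x"
  have x: "0 < x" "x \<le> 1/2" "x < 1" using assms by (auto simp: x_def field_simps)
  have X: "norm X < 1" using x by (simp add: X_def)
  define f a where "f = (\<lambda>n. complex_of_real (euler_coeff x n))"
    and "a = (\<lambda>n. complex_of_real (cauchy_coeff x n))"
  define F A where "F = Abs_fps f" and "A = Abs_fps a"
  have "ereal (1 / 1) \<le> fps_conv_radius F"
    unfolding F_def f_def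
    using x euler_coeff_le[of x]
    by (intro fps_conv_radius_ge_of_exp_bound[of _ "1 / (1 - x)\<^sup>2"] euler_coeff_nonneg) auto
  hence rF: "1 \<le> fps_conv_radius F" by (simp add: one_ereal_def)
  have rA: "ereal (1 / 16) \<le> fps_conv_radius A"
    unfolding A_def a_def
    using x cauchy_coeff_le_exp[of x] fps_conv_radius_ge_of_exp_bound[of "cauchy_coeff x" 1 16] cauchy_coeff_nonneg[of x]
    by auto
  have F_feq: "eval_fps F v = 1 / (1 - v) * eval_fps F (v * X)" if v: "norm v < 1" for v
  proof -
    have "F * (1 - fps_X) = Abs_fps (\<lambda>n. f n * X ^ n)"
    proof (rule fps_ext)
      fix n
      have "f n - f (n - 1) = f n * X ^ n" if "n > 0"
        using arg_cong[OF euler_coeff_rec[OF x(1) x(3) that], of complex_of_real]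
        by (simp add: f_def X_def)
      thus "fps_nth (F * (1 - fps_X)) n = fps_nth (Abs_fps (\<lambda>n. f n * X ^ n)) n"
        by (auto simp: algebra_simps F_def)
    qed
    hence "eval_fps F v * eval_fps (1 - fps_X) v = eval_fps F (v * X)"
      using v rF eval_fps_mult[of v F "1 - fps_X"] fps_conv_radius_diff[of "1::complex fps" fps_X]
      by (simp add: eval_fps_dilation F_def less_le_trans[of _ 1])
    moreover have "eval_fps (1 - fps_X) v = 1 - v"
      by (subst eval_fps_diff) auto
    moreover have "1 - v \<noteq> 0" using v by auto
    ultimately show ?thesis by (simp add: field_simps)
  qed
  have A_feq: "eval_fps A v = eval_fps F v * eval_fps A (v * X)" if v: "norm v < 1 / 16" for v
  proof -
    have conv: "A = F * Abs_fps (\<lambda>n. a n * X ^ n)"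
    proof (rule fps_ext)
      fix n
      have "cauchy_coeff x n = (\<Sum>m\<le>n. euler_coeff x (n - m) * (x ^ m * cauchy_coeff x m))"
        using x by (intro cauchy_coeff_convolution) auto
      also have "\<dots> = (\<Sum>m=0..n. euler_coeff x m * (x ^ (n - m) * cauchy_coeff x (n - m)))"
        by (subst sum.atLeastAtMost_rev) (auto simp: atLeast0AtMost intro!: sum.cong)
      finally show "fps_nth A n = fps_nth (F * Abs_fps (\<lambda>n. a n * X ^ n)) n"
        by (simp add: A_def F_def fps_mult_nth f_def a_def X_def mult_ac)
    qed
    have "norm v < fps_conv_radius F"
      using v by (intro less_le_trans[OF _ rF]) auto
    moreover have "norm v < fps_conv_radius (Abs_fps (\<lambda>n. a n * X ^ n))"
      using v X
      by (intro less_le_trans[OF _ order_trans[OF rA[unfolded A_def] fps_conv_radius_dilation]]) auto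
    ultimately have "eval_fps (F * Abs_fps (\<lambda>n. a n * X ^ n)) v = eval_fps F v * eval_fps A (v * X)"
      by (simp add: eval_fps_mult eval_fps_dilation A_def)
    thus ?thesis by (simp only: conv[symmetric])
  qed
  have at0: "eval_fps F 0 = 1" "eval_fps A 0 = 1"
    by (simp_all add: eval_fps_at_0 F_def A_def f_def a_def)
  have cont: "isCont (eval_fps F) 0" "isCont (eval_fps A) 0"
  proof -
    have "0 \<in> eball 0 (fps_conv_radius F)" "0 \<in> eball 0 (fps_conv_radius A)"
      using less_le_trans[OF _ rF, of 0] less_le_trans[OF _ rA, of 0] by (auto simp flip: zero_ereal_def)
    thus "isCont (eval_fps F) 0" "isCont (eval_fps A) 0"
      using continuous_on_eq_continuous_at[OF open_eball] continuous_on_eval_fps by blast+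
  qed
  obtain dF where dF: "dF > 0" "\<And>v. norm v < dF \<Longrightarrow> eval_fps F v \<noteq> 0"
    using continuous_at_avoid[OF cont(1), of 0] at0 by (auto simp: dist_norm)
  obtain dA where dA: "dA > 0" "\<And>v. norm v < dA \<Longrightarrow> eval_fps A v \<noteq> 0"
    using continuous_at_avoid[OF cont(2), of 0] at0 by (auto simp: dist_norm)
  \<comment> \<open>In this disc both series satisfy their functional equations and have no zeros.
    It is stable under multiplication by \<open>X\<close>, so all dilated arguments stay
    inside.\<close>
  define d where "d = min (min dF dA) (1/16)"
  have d: "d > 0" "\<And>v. norm v < d \<Longrightarrow> eval_fps F v \<noteq> 0 \<and> eval_fps A v \<noteq> 0 \<and> norm v < 1/16"
    using dF dA by (auto simp: d_def)
  have gen: "z_genfun q u = eval_fps A (u * X)" if u: "norm u < d" for u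
  proof -
    have small: "norm (u * X ^ i) < d" for i
    proof -
      have "norm (u * X ^ i) \<le> norm u * 1"
        unfolding norm_mult norm_power using X by (intro mult_left_mono power_le_one) auto
      thus ?thesis using u by simp
    qed
    have inner: "(\<Prod>j. 1 / (1 - u / of_real q ^ (Suc i + j))) = eval_fps F (u * X * X ^ i)" for i
    proof -
      have "(\<Prod>j. 1 / (1 - u / of_real q ^ (Suc i + j))) = (\<Prod>j. 1 / (1 - (u * X ^ Suc i) * X ^ j))"
        by (simp add: X_def x_def power_add power_divide field_simps)
      also have "\<dots> = eval_fps F (u * X ^ Suc i)"
      proof (rule prodinf_dilation[OF X cont(1) at0(1)])
        show "eval_fps F v = 1 / (1 - v) * eval_fps F (v * X)" if "norm v \<le> norm (u * X ^ Suc i)" for v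
          using that small[of "Suc i"] d(2)[of "u * X ^ Suc i"] by (intro F_feq) auto
        show "eval_fps F (u * X ^ Suc i) \<noteq> 0" using d(2) small by blast
      qed
      finally show ?thesis by (simp add: mult_ac)
    qed
    have "z_genfun q u = (\<Prod>i. eval_fps F (u * X * X ^ i))"
      unfolding z_genfun_def inner ..
    also have "\<dots> = eval_fps A (u * X)"
    proof (rule prodinf_dilation[OF X cont(2) at0(2)])
      show "eval_fps A v = eval_fps F v * eval_fps A (v * X)" if "norm v \<le> norm (u * X)" for v
        using that small[of 1] d(2)[of "u * X"] by (intro A_feq) auto
      show "eval_fps A (u * X) \<noteq> 0" using d(2) small[of 1] by simp
    qed
    finally show ?thesis .
  qed
  define G where "G = Abs_fps (\<lambda>n. a n * X ^ n)"
  have "0 < fps_conv_radius G"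
  proof -
    have "(0::ereal) < ereal (1 / 16)" by simp
    also have "\<dots> \<le> fps_conv_radius G"
      using order_trans[OF rA[unfolded A_def] fps_conv_radius_dilation[of X a]] X by (simp add: G_def)
    finally show ?thesis .
  qed
  moreover have "eventually (\<lambda>u. eval_fps G u = z_genfun q u) (nhds 0)"
    unfolding eventually_nhds_metric using d(1) gen
    by (auto simp: dist_norm eval_fps_dilation G_def A_def)
  ultimately have "z_genfun q has_fps_expansion G"
    by (simp add: has_fps_expansion_def)
  hence "fps_expansion (z_genfun q) 0 = G" by (rule fps_expansion_eqI)
  thus ?thesis by (simp add: z_coeff_def G_def a_def X_def x_def flip: of_real_power of_real_mult)
qed

section \<open>Partitions by first row\<close>

text \<open>The hook product is at least \<open>(1 - x)\<^sup>2\<close> on each row; squaring it gives the exponent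
  \<open>4 * length l\<close>.\<close>

definition row_weight :: "real \<Rightarrow> nat list \<Rightarrow> real" where
  "row_weight x l = x ^ (2 * n_stat l) / (1 - x) ^ (4 * length l)"

definition row_weight_sum :: "real \<Rightarrow> nat \<Rightarrow> real" where
  "row_weight_sum x n = (\<Sum>l\<in>partitions n. row_weight x l)"

text \<open>A new first row pushes every cell of \<open>l\<close> down by one, and each cell then
  contributes one more.\<close>

lemma n_stat_Cons: "n_stat (c # l) = sum_list l + n_stat l"
proof -
  have eq: "n_stat l = (\<Sum>i<length l. i * l ! i)" for l
  proof -
    have "n_stat l = (\<Sum>i\<in>Suc ` {..<length l}. (i - 1) * part l i)"
      unfolding n_stat_def by (simp only: image_Suc_lessThan)
    also have "\<dots> = (\<Sum>i<length l. i * l ! i)"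
      by (subst sum.reindex) (auto simp: part_def intro!: sum.cong)
    finally show ?thesis .
  qed
  show ?thesis
    unfolding eq
    by (simp add: sum.lessThan_Suc_shift sum.distrib sum_list_sum_nth atLeast0LessThan
        del: sum.lessThan_Suc)
qed

lemma partitions_0: "partitions 0 = {[]}"
proof -
  have "l = []" if "sum_list l = 0" "\<forall>x\<in>set l. 1 \<le> x" for l :: "nat list"
    using that by (cases l) auto
  thus ?thesis by (auto simp: partitions_def)
qed

text \<open>Here \<open>d\<close> is the size of what is left after removing the first row:
  \<open>n - d < r\<close> gives the lower end of the range, and positivity of the row gives
  \<open>d < n\<close>. This is only an inclusion, since the right-hand side ignores the order
  between the first two rows.\<close>

lemma partitions_first_part_less:
  assumes "n > 0"
  shows "{l \<in> partitions n. part l 1 < r} \<subseteq> (\<lambda>(d, l). (n - d) # l) ` (SIGMA d:{n + 1 - r..<n}. partitions d)"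
proof
  fix l assume l: "l \<in> {l \<in> partitions n. part l 1 < r}"
  then obtain c m where cm: "l = c # m" using assms by (cases l) (auto simp: partitions_def)
  hence "m \<in> partitions (sum_list m)" "n - sum_list m = c" "sum_list m \<in> {n + 1 - r..<n}"
    using l by (auto simp: partitions_def part_def)
  thus "l \<in> (\<lambda>(d, l). (n - d) # l) ` (SIGMA d:{n + 1 - r..<n}. partitions d)"
    using cm by (force intro: rev_image_eqI[of "(sum_list m, m)"])
qed

lemma part_1_le:
  assumes "l \<in> partitions n"
  shows "part l 1 \<le> n"
  using assms by (cases l) (auto simp: partitions_def part_def)

lemma finite_partitions: "finite (partitions n)"
proof (induction n rule: less_induct)
  case (less n)
  show ?case
  proof (cases "n = 0")
    case False
    have "partitions n = {l \<in> partitions n. part l 1 < n + 1}" using part_1_le by fastforce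
    also have "\<dots> \<subseteq> (\<lambda>(d, l). (n - d) # l) ` (SIGMA d:{n + 1 - (n + 1)..<n}. partitions d)"
      using False by (intro partitions_first_part_less) auto
    finally show ?thesis by (rule finite_subset) (use less in \<open>auto intro!: finite_imageI finite_SigmaI\<close>)
  qed (simp add: partitions_0)
qed

lemma row_weight_nonneg: "x < 1 \<Longrightarrow> 0 \<le> x \<Longrightarrow> 0 \<le> row_weight x l"
  by (simp add: row_weight_def)

lemma row_weight_sum_nonneg: "x < 1 \<Longrightarrow> 0 \<le> x \<Longrightarrow> 0 \<le> row_weight_sum x n"
  unfolding row_weight_sum_def by (intro sum_nonneg row_weight_nonneg)

text \<open>Prepending a row to a partition of \<open>d\<close> multiplies the weight by
  \<open>x ^ (2 * d) / (1 - x) ^ 4\<close>; the lists counted in excess have nonnegative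
  weight.\<close>

lemma row_weight_sum_first_part_less:
  assumes "0 \<le> x" "x < 1" "n > 0"
  shows "(\<Sum>l | l \<in> partitions n \<and> part l 1 < r. row_weight x l)
    \<le> (\<Sum>d=n + 1 - r..<n. x ^ (2 * d) * row_weight_sum x d) / (1 - x) ^ 4"
proof -
  let ?S = "SIGMA d:{n + 1 - r..<n}. partitions d" and ?g = "\<lambda>(d, l). (n - d) # l"
  have fin: "finite ?S" by (intro finite_SigmaI finite_partitions) auto
  have inj: "inj_on ?g ?S" by (auto simp: inj_on_def partitions_def)
  have "(\<Sum>l | l \<in> partitions n \<and> part l 1 < r. row_weight x l) \<le> (\<Sum>l\<in>?g ` ?S. row_weight x l)"
    using partitions_first_part_less[OF assms(3), of r] fin assms
    by (intro sum_mono2 row_weight_nonneg) auto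
  also have "\<dots> = (\<Sum>(d, l)\<in>?S. row_weight x ((n - d) # l))"
    by (subst sum.reindex[OF inj]) (simp add: case_prod_unfold)
  also have "\<dots> = (\<Sum>d=n + 1 - r..<n. \<Sum>l\<in>partitions d. row_weight x ((n - d) # l))"
    by (subst sum.Sigma) (auto intro: finite_partitions)
  also have "\<dots> = (\<Sum>d=n + 1 - r..<n. \<Sum>l\<in>partitions d. x ^ (2 * d) * row_weight x l / (1 - x) ^ 4)"
    by (intro sum.cong refl)
       (auto simp: row_weight_def n_stat_Cons partitions_def power_add distrib_left)
  also have "\<dots> = (\<Sum>d=n + 1 - r..<n. x ^ (2 * d) * row_weight_sum x d) / (1 - x) ^ 4"
    by (simp add: row_weight_sum_def sum_distrib_left sum_divide_distrib)
  finally show ?thesis .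
qed

lemma row_weight_sum_0: "row_weight_sum x 0 = 1"
  by (simp add: row_weight_sum_def partitions_0 row_weight_def n_stat_def)

lemma row_weight_sum_rec:
  assumes "0 \<le> x" "x < 1" "n > 0"
  shows "row_weight_sum x n \<le> (\<Sum>d<n. x ^ (2 * d) * row_weight_sum x d) / (1 - x) ^ 4"
proof -
  have "{l. l \<in> partitions n \<and> part l 1 < n + 1} = partitions n" using part_1_le by fastforce
  thus ?thesis
    using row_weight_sum_first_part_less[OF assms, of "n + 1"]
    by (simp add: row_weight_sum_def atLeast0LessThan)
qed

lemma row_weight_sum_1_le:
  assumes "0 \<le> x" "x < 1"
  shows "row_weight_sum x 1 \<le> 1 / (1 - x) ^ 4"
  using row_weight_sum_rec[OF assms, of 1] by (simp add: row_weight_sum_0)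

lemma row_weight_sum_2_le:
  assumes "0 \<le> x" "x < 1"
  shows "row_weight_sum x 2 \<le> (1 + x\<^sup>2 / (1 - x) ^ 4) / (1 - x) ^ 4"
proof -
  have "row_weight_sum x 2 \<le> (1 + x\<^sup>2 * row_weight_sum x 1) / (1 - x) ^ 4"
    using row_weight_sum_rec[OF assms, of 2] by (simp add: row_weight_sum_0 numeral_2_eq_2)
  also have "\<dots> \<le> (1 + x\<^sup>2 * (1 / (1 - x) ^ 4)) / (1 - x) ^ 4"
    using assms row_weight_sum_1_le[OF assms] by (intro divide_right_mono add_left_mono mult_left_mono) auto
  finally show ?thesis by simp
qed

text \<open>A bound uniform in \<open>n\<close>, by induction: the sum in the recursion is at most
  \<open>1 / (1 - x) ^ 4\<close>, and the recursion divides by \<open>(1 - x) ^ 4\<close> once more.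
  The terms d = 0, 1, 2 are treated separately because the margin is small: at x = 1/2 the estimate
  gives 46/3 against the allowed 16.\<close>

lemma row_weight_sum_le:
  assumes x: "0 < x" "x \<le> 1/2"
  shows "row_weight_sum x n \<le> 1 / (1 - x) ^ 8"
proof (induction n rule: less_induct)
  case (less n)
  define w where "w = 1 - x"
  have w: "0 < w" "w < 1" "x \<le> w" using x by (auto simp: w_def)
  note nn = row_weight_sum_nonneg[of x]
  show ?case
  proof (cases "n = 0")
    case True
    have "w ^ 8 \<le> 1" using w by (intro power_le_one) auto
    thus ?thesis using True w unfolding w_def[symmetric] by (simp add: row_weight_sum_0)
  next
    case False
    have x2: "0 < 1 - x\<^sup>2" using x by (intro one_minus_power_pos) auto
    have "(\<Sum>d<n. x ^ (2 * d) * row_weight_sum x d)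
        \<le> (\<Sum>d\<in>{0,1,2} \<union> {3..<n}. x ^ (2 * d) * row_weight_sum x d)"
      using x by (intro sum_mono2 mult_nonneg_nonneg nn) auto
    also have "\<dots> = 1 + x\<^sup>2 * row_weight_sum x 1 + x ^ 4 * row_weight_sum x 2
        + (\<Sum>d=3..<n. x ^ (2 * d) * row_weight_sum x d)"
      by (subst sum.union_disjoint) (auto simp: row_weight_sum_0)
    also have "(\<Sum>d=3..<n. x ^ (2 * d) * row_weight_sum x d) \<le> (\<Sum>d=3..<n. 1 / w ^ 8 * (x\<^sup>2) ^ d)"
    proof (intro sum_mono)
      fix d assume "d \<in> {3..<n}"
      hence "x ^ (2 * d) * row_weight_sum x d \<le> x ^ (2 * d) * (1 / w ^ 8)"
        unfolding w_def using x by (intro mult_left_mono less) auto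
      thus "x ^ (2 * d) * row_weight_sum x d \<le> 1 / w ^ 8 * (x\<^sup>2) ^ d"
        by (simp add: power_mult)
    qed
    also have "\<dots> = 1 / w ^ 8 * (\<Sum>d=3..<n. (x\<^sup>2) ^ d)" by (simp add: sum_distrib_left)
    also have "\<dots> \<le> 1 / w ^ 8 * ((x\<^sup>2) ^ 3 / (1 - x\<^sup>2))"
      using x w x2 by (intro mult_left_mono geometric_tail_le) auto
    also have "\<dots> = 1 / w ^ 8 * (x ^ 6 * (1 / (1 - x\<^sup>2)))" by (simp flip: power_mult)
    also have "\<dots> \<le> 1 / w ^ 8 * (x ^ 6 * (4 / 3))"
    proof (intro mult_left_mono)
      have "x\<^sup>2 \<le> (1/2)\<^sup>2" using x by (intro power_mono) auto
      thus "1 / (1 - x\<^sup>2) \<le> 4 / 3" using x2 by (simp add: power2_eq_square field_simps)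
    qed (use x w in auto)
    also have "1 + x\<^sup>2 * row_weight_sum x 1 + x ^ 4 * row_weight_sum x 2 + 1 / w ^ 8 * (x ^ 6 * (4 / 3))
       \<le> 1 + x\<^sup>2 * (1 / w ^ 4) + x ^ 4 * ((1 + x\<^sup>2 / w ^ 4) / w ^ 4) + 1 / w ^ 8 * (x ^ 6 * (4 / 3))"
      unfolding w_def using x
      by (intro add_right_mono add_mono order_refl mult_left_mono row_weight_sum_1_le row_weight_sum_2_le) auto
    \<comment> \<open>The constant 7/3 is 1 + 4/3, from the term d = 2 and the geometric
      tail.\<close>
    also have "\<dots> = (w ^ 4 + x\<^sup>2 + x ^ 4 + 7 / 3 * x\<^sup>2 * (x ^ 4 / w ^ 4)) / w ^ 4"
      using w by (simp add: field_simps power2_eq_square eval_nat_numeral)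
    also have "\<dots> \<le> (w ^ 4 + x\<^sup>2 + x ^ 4 + 7 / 3 * x\<^sup>2 * 1) / w ^ 4"
      using w x power_mono[of x w 4] by (intro divide_right_mono add_left_mono mult_left_mono) auto
    also have "\<dots> \<le> 1 / w ^ 4"
    proof (intro divide_right_mono)
      \<comment> \<open>The polynomial in \<open>x\<close> obtained below decreases on the interval
        up to 1/2, so the tangent of the square is taken at 1/2, the critical end.\<close>
      have "0 \<le> (x - 1/2)\<^sup>2" by simp
      hence "x \<le> x\<^sup>2 + 1/4" by (simp add: power2_eq_square algebra_simps)
      moreover have "x\<^sup>2 * x \<le> x\<^sup>2 * (1/2)" using x by (intro mult_left_mono) auto
      ultimately have "0 \<le> 4 - 28 / 3 * x + 4 * x\<^sup>2 - 2 * (x\<^sup>2 * x)"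
        using x by linarith
      hence "0 \<le> x * (4 - 28 / 3 * x + 4 * x\<^sup>2 - 2 * (x\<^sup>2 * x))" using x by simp
      also have "\<dots> = 1 - (w ^ 4 + x\<^sup>2 + x ^ 4 + 7 / 3 * x\<^sup>2 * 1)"
        by (simp add: w_def algebra_simps power2_eq_square eval_nat_numeral)
      finally show "w ^ 4 + x\<^sup>2 + x ^ 4 + 7 / 3 * x\<^sup>2 * 1 \<le> 1" by simp
    qed (use w in auto)
    finally have "(\<Sum>d<n. x ^ (2 * d) * row_weight_sum x d) / w ^ 4 \<le> 1 / w ^ 4 / w ^ 4"
      using w by (intro divide_right_mono) auto
    thus ?thesis
      using row_weight_sum_rec[of x n] x False by (simp add: w_def flip: power_add)
  qed
qed

text \<open>The exponent is 13 = 8 + 1 + 4: the uniform bound, the geometric series with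
  \<open>1 - x \<le> 1 - x^2\<close>, and the removed first row.\<close>

lemma row_weight_sum_first_part_less_le:
  assumes x: "0 < x" "x \<le> 1/2" and n: "n \<ge> 4"
  shows "(\<Sum>l | l \<in> partitions n \<and> part l 1 < r. row_weight x l) \<le> x ^ (2 * (n + 1 - r)) / (1 - x) ^ 13"
proof -
  define w where "w = 1 - x"
  have w: "0 < w" "w < 1" "w \<le> 1 - x\<^sup>2" using x by (auto simp: w_def power2_eq_square mult_left_le)
  have "(\<Sum>d=n + 1 - r..<n. x ^ (2 * d) * row_weight_sum x d) \<le> (\<Sum>d=n + 1 - r..<n. 1 / w ^ 8 * (x\<^sup>2) ^ d)"
  proof (intro sum_mono)
    fix d
    have "x ^ (2 * d) * row_weight_sum x d \<le> x ^ (2 * d) * (1 / w ^ 8)"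
      unfolding w_def using x by (intro mult_left_mono row_weight_sum_le) auto
    thus "x ^ (2 * d) * row_weight_sum x d \<le> 1 / w ^ 8 * (x\<^sup>2) ^ d" by (simp add: power_mult)
  qed
  also have "\<dots> = 1 / w ^ 8 * (\<Sum>d=n + 1 - r..<n. (x\<^sup>2) ^ d)" by (simp add: sum_distrib_left)
  also have "\<dots> \<le> 1 / w ^ 8 * ((x\<^sup>2) ^ (n + 1 - r) / (1 - x\<^sup>2))"
    using x w by (intro mult_left_mono geometric_tail_le) auto
  also have "\<dots> \<le> 1 / w ^ 8 * ((x\<^sup>2) ^ (n + 1 - r) / w)"
    using x w by (intro mult_left_mono divide_left_mono) auto
  finally have "(\<Sum>d=n + 1 - r..<n. x ^ (2 * d) * row_weight_sum x d) / w ^ 4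
      \<le> 1 / w ^ 8 * ((x\<^sup>2) ^ (n + 1 - r) / w) / w ^ 4"
    using w by (intro divide_right_mono) auto
  also have "\<dots> = x ^ (2 * (n + 1 - r)) / (w ^ 8 * w * w ^ 4)"
    by (simp add: power_mult)
  also have "w ^ 8 * w * w ^ 4 = w ^ 13"
    by (simp add: eval_nat_numeral)
  finally show ?thesis
    using row_weight_sum_first_part_less[of x n r] x n by (simp add: w_def)
qed

text \<open>For n = 3 the exponent 1 + 4 sqrt(6) of the claim lies below 11, so the general estimate
  is too weak. Here at most the term d = 2 occurs, and the sharper bound on
  \<open>row_weight_sum x 2\<close> applies.\<close>

lemma row_weight_sum_first_part_less_le_3:
  assumes x: "0 < x" "x \<le> 1/2" and r: "1 \<le> r" "r \<le> 2"
  shows "(\<Sum>l | l \<in> partitions 3 \<and> part l 1 < r. row_weight x l) \<le> x ^ (2 * (3 + 1 - r)) / (1 - x) ^ 11"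
proof (cases "r = 1")
  case True
  have "(\<Sum>l | l \<in> partitions 3 \<and> part l 1 < r. row_weight x l) \<le> 0"
    using row_weight_sum_first_part_less[of x 3 r] x True by simp
  also have "0 \<le> x ^ (2 * (3 + 1 - r)) / (1 - x) ^ 11" using x by simp
  finally show ?thesis .
next
  case False
  hence r2: "r = 2" using r by simp
  define w where "w = 1 - x"
  have w: "0 < w" "w < 1" "x \<le> w" using x by (auto simp: w_def)
  have "w ^ 3 * w ^ 4 + x\<^sup>2 * w ^ 3 \<le> w ^ 4"
  proof -
    have "x * x \<le> x * w" using w x by (intro mult_left_mono) auto
    moreover have "w ^ 4 \<le> w ^ 2" using w by (intro power_decreasing) auto
    ultimately have "w ^ 4 + x\<^sup>2 \<le> w\<^sup>2 + x * w" by (simp add: power2_eq_square)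
    also have "\<dots> = w" by (simp add: w_def power2_eq_square algebra_simps)
    finally have "w ^ 3 * (w ^ 4 + x\<^sup>2) \<le> w ^ 3 * w" using w by (intro mult_left_mono) auto
    thus ?thesis by (simp add: algebra_simps eval_nat_numeral)
  qed
  hence "(w ^ 3 * w ^ 4 + x\<^sup>2 * w ^ 3) / w ^ 15 \<le> w ^ 4 / w ^ 15"
    using w by (intro divide_right_mono) auto
  moreover have "(w ^ 3 * w ^ 4 + x\<^sup>2 * w ^ 3) / w ^ 15 = (1 + x\<^sup>2 / w ^ 4) / w ^ 4 / w ^ 4"
    using w by (simp add: field_simps eval_nat_numeral)
  moreover have "w ^ 4 / w ^ 15 = 1 / w ^ 11"
    using w by (simp add: eval_nat_numeral)
  ultimately have 1: "(1 + x\<^sup>2 / w ^ 4) / w ^ 4 / w ^ 4 \<le> 1 / w ^ 11" by simp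
  have "(\<Sum>l | l \<in> partitions 3 \<and> part l 1 < r. row_weight x l) \<le> x ^ 4 * row_weight_sum x 2 / w ^ 4"
  proof -
    have "{3 + 1 - 2..<3} = {2::nat}" by auto
    thus ?thesis using row_weight_sum_first_part_less[of x 3 2] x by (simp add: r2 w_def)
  qed
  also have "\<dots> \<le> x ^ 4 * ((1 + x\<^sup>2 / w ^ 4) / w ^ 4) / w ^ 4"
    unfolding w_def using x by (intro divide_right_mono mult_left_mono row_weight_sum_2_le) auto
  also have "\<dots> \<le> x ^ 4 * (1 / w ^ 11)"
    using x mult_left_mono[OF 1, of "x ^ 4"] by simp
  finally show ?thesis by (simp add: r2 w_def)
qed

section \<open>Hook products\<close>

lemma diagram_eq: "diagram l = (SIGMA i:{1..length l}. {1..part l i})"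
  by (auto simp: diagram_def)

lemma arm_eq:
  assumes "1 \<le> i" "i \<le> length l" "1 \<le> j"
  shows "arm l (i, j) = part l i - j"
proof -
  have "{t \<in> diagram l. fst t = fst (i, j) \<and> snd t > snd (i, j)} = Pair i ` {j<..part l i}"
    using assms by (auto simp: diagram_eq)
  thus ?thesis by (simp add: arm_def card_image inj_on_def)
qed

lemma hook_prod_pos:
  fixes x :: real
  assumes "0 < x" "x < 1"
  shows "0 < (\<Prod>s\<in>diagram l. 1 - x ^ hook l s)"
  using assms by (intro prod_pos one_minus_power_pos) (auto simp: hook_def)

lemma hook_prod_le_1:
  fixes x :: real
  assumes "0 < x" "x < 1"
  shows "(\<Prod>s\<in>diagram l. 1 - x ^ hook l s) \<le> 1"
  using assms by (intro prod_le_1) (auto simp: power_le_one)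

text \<open>Hooks are longer than arms, and \<open>arm + 1\<close> takes each value
  \<open>1, \<dots>, part l i\<close> once along row \<open>i\<close>.\<close>

lemma hook_prod_ge:
  assumes x: "0 < x" "x \<le> (1/2 :: real)"
  shows "(1 - x) ^ (2 * length l) \<le> (\<Prod>s\<in>diagram l. 1 - x ^ hook l s)"
proof -
  have "(1 - x) ^ (2 * length l) = (\<Prod>i=1..length l. (1 - x)\<^sup>2)"
    by (simp add: power_mult)
  also have "\<dots> \<le> (\<Prod>i=1..length l. \<Prod>j=1..part l i. 1 - x ^ hook l (i, j))"
  proof (intro prod_mono conjI)
    fix i assume i: "i \<in> {1..length l}"
    have "(1 - x)\<^sup>2 \<le> (\<Prod>k=1..part l i. 1 - x ^ k)"
      by (rule euler_prod_ge[OF x])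
    also have "\<dots> = (\<Prod>j=1..part l i. 1 - x ^ (part l i + 1 - j))"
      by (rule prod.atLeastAtMost_rev)
    also have "\<dots> \<le> (\<Prod>j=1..part l i. 1 - x ^ hook l (i, j))"
    proof (intro prod_mono conjI)
      fix j assume j: "j \<in> {1..part l i}"
      have "part l i + 1 - j \<le> hook l (i, j)"
        using i j by (auto simp: hook_def arm_eq)
      thus "1 - x ^ (part l i + 1 - j) \<le> 1 - x ^ hook l (i, j)"
        using x by (simp add: power_decreasing)
    qed (use x in \<open>auto simp: power_le_one\<close>)
    finally show "(1 - x)\<^sup>2 \<le> (\<Prod>j=1..part l i. 1 - x ^ hook l (i, j))" .
  qed auto
  also have "\<dots> = (\<Prod>s\<in>diagram l. 1 - x ^ hook l s)"
    unfolding diagram_eq by (subst prod.Sigma) auto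
  finally show ?thesis .
qed

text \<open>The power \<open>(1 / q) ^ n\<close> in the normalising constant cancels against
  \<open>q ^ sum_list l\<close>.\<close>

lemma Q_mass_eq:
  assumes "q \<ge> 2" "sum_list l = n"
  shows "Q_mass n q l = (1 / q) ^ (2 * n_stat l) /
    (cauchy_coeff (1 / q) n * (\<Prod>s\<in>diagram l. 1 - (1 / q) ^ hook l s)\<^sup>2)"
  using assms
  by (simp add: Q_mass_def z_coeff_eq power_divide power_add prod_power_distrib field_simps)

lemma Q_mass_nonneg:
  assumes "q \<ge> 2" "sum_list l = n"
  shows "0 \<le> Q_mass n q l"
  unfolding Q_mass_eq[OF assms] using assms
  by (intro divide_nonneg_nonneg mult_nonneg_nonneg cauchy_coeff_nonneg) auto

text \<open>The squared hook product yields the row weight, and the lower bound on the normalising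
  coefficient yields the factor \<open>1 - 1 / q\<close>.\<close>

lemma Q_mass_le:
  assumes "q \<ge> 2" "sum_list l = n" "n > 0"
  shows "Q_mass n q l \<le> (1 - 1 / q) * row_weight (1 / q) l"
proof -
  define x where "x = 1 / q"
  have x: "0 < x" "x \<le> 1/2" "x < 1" using assms by (auto simp: x_def field_simps)
  let ?P = "\<Prod>s\<in>diagram l. 1 - x ^ hook l s"
  have c: "1 / (1 - x) \<le> cauchy_coeff x n" using x assms by (intro cauchy_coeff_ge) auto
  have "((1 - x) ^ (2 * length l))\<^sup>2 \<le> ?P\<^sup>2"
    using x by (intro power_mono hook_prod_ge) auto
  hence P: "(1 - x) ^ (4 * length l) \<le> ?P\<^sup>2" by (simp flip: power_mult)
  have "1 / (1 - x) * (1 - x) ^ (4 * length l) \<le> cauchy_coeff x n * ?P\<^sup>2"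
    using x c P by (intro mult_mono cauchy_coeff_nonneg) auto
  moreover have "0 < cauchy_coeff x n * ?P\<^sup>2"
    using x hook_prod_pos[of x l] by (intro mult_pos_pos cauchy_coeff_pos zero_less_power) auto
  moreover have "0 < 1 / (1 - x) * (1 - x) ^ (4 * length l)" using x by simp
  ultimately have "x ^ (2 * n_stat l) / (cauchy_coeff x n * ?P\<^sup>2)
      \<le> x ^ (2 * n_stat l) / (1 / (1 - x) * (1 - x) ^ (4 * length l))"
    using x by (intro divide_left_mono mult_pos_pos[of "cauchy_coeff x n * ?P\<^sup>2"]) simp_all
  thus ?thesis
    unfolding Q_mass_eq[OF assms(1,2)] x_def[symmetric] by (simp add: row_weight_def mult.commute)
qed

lemma Q_mass_ge:
  assumes "q \<ge> 2" "sum_list l = n" "n > 0"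
  shows "(1 / q) ^ (2 * n_stat l) / cauchy_coeff (1 / q) n \<le> Q_mass n q l"
proof -
  define x where "x = 1 / q"
  have x: "0 < x" "x \<le> 1/2" "x < 1" using assms by (auto simp: x_def field_simps)
  let ?P = "\<Prod>s\<in>diagram l. 1 - x ^ hook l s"
  have c: "0 < cauchy_coeff x n" using x by (intro cauchy_coeff_pos) auto
  have P: "0 < ?P" "?P\<^sup>2 \<le> 1"
    using x hook_prod_pos[of x l] hook_prod_le_1[of x l] by (auto intro!: power_le_one)
  have "cauchy_coeff x n * ?P\<^sup>2 \<le> cauchy_coeff x n * 1"
    using c P by (intro mult_left_mono) auto
  hence "x ^ (2 * n_stat l) / cauchy_coeff x n \<le> x ^ (2 * n_stat l) / (cauchy_coeff x n * ?P\<^sup>2)"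
    using c P x by (intro divide_left_mono mult_pos_pos) auto
  thus ?thesis
    unfolding Q_mass_eq[OF assms(1,2)] x_def[symmetric] .
qed

section \<open>The probability of a short first row: upper and lower bound\<close>

lemma Q_prob_eq:
  assumes "q \<ge> 2"
  shows "Q_prob n q r = (\<Sum>l | l \<in> partitions n \<and> part l 1 < r. Q_mass n q l)"
proof -
  have "0 \<le> Q_mass n q l" if "l \<in> partitions n" for l
    using that assms by (intro Q_mass_nonneg) (auto simp: partitions_def)
  thus ?thesis
    unfolding Q_prob_def Q_measure_def
    by (subst measure_point_measure_finite_if[OF finite_partitions]) (auto simp: space_point_measure)
qed

text \<open>This already gives the upper bound with the first summand of its bracket alone.\<close>

lemma Q_prob_le:
  assumes q: "q \<ge> 2" and r: "r > 0" "r \<le> n - 1" and x: "x = 1 / q"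
  shows "Q_prob n q r \<le> 1 / (1 - x) powr (1 + 4 * sqrt (2 * real n)) * x ^ (2 * (n + 1 - r))"
proof -
  have x': "0 < x" "x \<le> 1/2" "x < 1" using q by (auto simp: x field_simps)
  have powr_le: "1 / (1 - x) ^ k \<le> 1 / (1 - x) powr (1 + 4 * sqrt (2 * real n))"
    if "real k \<le> 1 + 4 * sqrt (2 * real n)" for k
  proof -
    have "(1 - x) powr (1 + 4 * sqrt (2 * real n)) \<le> (1 - x) powr real k"
      using x' that by (intro powr_mono') auto
    thus ?thesis using x' by (intro divide_left_mono) (auto simp: powr_realpow)
  qed
  have "Q_prob n q r \<le> (\<Sum>l | l \<in> partitions n \<and> part l 1 < r. (1 - x) * row_weight x l)"
    unfolding Q_prob_eq[OF q] x using q r by (intro sum_mono Q_mass_le) (auto simp: partitions_def)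
  also have "\<dots> = (1 - x) * (\<Sum>l | l \<in> partitions n \<and> part l 1 < r. row_weight x l)"
    by (simp add: sum_distrib_left)
  also have "\<dots> \<le> 1 / (1 - x) powr (1 + 4 * sqrt (2 * real n)) * x ^ (2 * (n + 1 - r))"
  proof -
    \<comment> \<open>The available exponent is 9 for n = 2, where the sum is empty, about 10.8 for
      n = 3, and more than 12 from n = 4 on.\<close>
    consider "n = 2" "r = 1" | "n = 3" "r \<le> 2" | "n \<ge> 4" using r by linarith
    thus ?thesis
    proof cases
      case 1
      thus ?thesis using row_weight_sum_first_part_less[of x 2 1] x'
        by (auto intro!: order_trans[OF mult_nonneg_nonpos])
    next
      case 2
      have "(1 - x) * (\<Sum>l | l \<in> partitions n \<and> part l 1 < r. row_weight x l)
          \<le> (1 - x) * (x ^ (2 * (n + 1 - r)) / (1 - x) ^ 11)"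
        using row_weight_sum_first_part_less_le_3[of x r] x' 2 r by (intro mult_left_mono) auto
      also have "\<dots> = 1 / (1 - x) ^ 10 * x ^ (2 * (n + 1 - r))"
        using x' by (simp add: eval_nat_numeral)
      also have "\<dots> \<le> 1 / (1 - x) powr (1 + 4 * sqrt (2 * real n)) * x ^ (2 * (n + 1 - r))"
      proof (intro mult_right_mono powr_le)
        \<comment> \<open>9/4 = (10 - 1) / 4, and its square 81/16 is below 6; likewise 11/4 = (12 -
          1) / 4 in the next case.\<close>
        have "9 / 4 \<le> sqrt (2 * real n)"
          using 2 by (intro real_le_rsqrt) (simp add: power2_eq_square)
        thus "real 10 \<le> 1 + 4 * sqrt (2 * real n)" by simp
      qed (use x' in auto)
      finally show ?thesis .
    next
      case 3
      have "(1 - x) * (\<Sum>l | l \<in> partitions n \<and> part l 1 < r. row_weight x l)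
          \<le> (1 - x) * (x ^ (2 * (n + 1 - r)) / (1 - x) ^ 13)"
        using x' 3 by (intro mult_left_mono row_weight_sum_first_part_less_le) auto
      also have "\<dots> = 1 / (1 - x) ^ 12 * x ^ (2 * (n + 1 - r))"
        using x' by (simp add: eval_nat_numeral)
      also have "\<dots> \<le> 1 / (1 - x) powr (1 + 4 * sqrt (2 * real n)) * x ^ (2 * (n + 1 - r))"
      proof (intro mult_right_mono powr_le)
        have "11 / 4 \<le> sqrt (2 * real n)"
          using 3 by (intro real_le_rsqrt) (simp add: power2_eq_square)
        thus "real 12 \<le> 1 + 4 * sqrt (2 * real n)" by simp
      qed (use x' in auto)
      finally show ?thesis .
    qed
  qed
  finally show ?thesis .
qed

lemma Q_prob_nonneg: "0 \<le> Q_prob n q r"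
  by (simp add: Q_prob_def)

lemma Q_prob_ge:
  assumes q: "q \<ge> 2" and r: "r > 0" "r \<le> n - 1" and two_rows: "n + 1 < 2 * r"
    and x: "x = 1 / q" and small: "x < (1 - x)\<^sup>2"
  shows "(1 - x ^ n) * ((1 - x)\<^sup>2 * ((1 - x)\<^sup>2 - x)) * x ^ (2 * (n + 1 - r)) \<le> Q_prob n q r"
proof -
  have x': "0 < x" "x \<le> 1/2" "x < 1" using q by (auto simp: x field_simps)
  \<comment> \<open>The longest admissible first row with everything else in a second row. The
    assumption \<open>two_rows\<close> says exactly that the rows are in order, and
    \<open>n_stat l\<close> is the second row.\<close>
  define l where "l = [r - 1, n + 1 - r]"
  have l: "l \<in> partitions n" "part l 1 < r" "n_stat l = n + 1 - r" "sum_list l = n"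
    using r two_rows by (auto simp: l_def partitions_def part_def n_stat_Cons) (simp add: n_stat_def)
  have c: "0 < cauchy_coeff x n" using x' by (intro cauchy_coeff_pos) auto
  have "(1 - x ^ n) * ((1 - x)\<^sup>2 * ((1 - x)\<^sup>2 - x)) \<le> 1 / cauchy_coeff x n"
    using cauchy_coeff_upper[of x n] x' small r c by (simp add: field_simps)
  hence "(1 - x ^ n) * ((1 - x)\<^sup>2 * ((1 - x)\<^sup>2 - x)) * x ^ (2 * (n + 1 - r))
      \<le> 1 / cauchy_coeff x n * x ^ (2 * (n + 1 - r))"
    using x' by (intro mult_right_mono) auto
  also have "\<dots> \<le> Q_mass n q l"
    using Q_mass_ge[OF q l(4)] r l by (simp add: x)
  also have "\<dots> = (\<Sum>l\<in>{l}. Q_mass n q l)" by simp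
  also have "\<dots> \<le> Q_prob n q r"
  proof -
    have "finite {l. l \<in> partitions n \<and> part l 1 < r}" using finite_partitions[of n] by simp
    thus ?thesis
      unfolding Q_prob_eq[OF q] using l(1,2) q
      by (intro sum_mono2 Q_mass_nonneg) (auto simp: partitions_def)
  qed
  finally show ?thesis .
qed

theorem theorem6:
  fixes q :: real and n r :: nat
  assumes "q \<ge> 2" and "n > 0" and "r > 0" and "r \<le> n - 1"
  shows
    "Q_prob n q r \<le> 1 / (1 - 1 / q) powr (1 + 4 * sqrt (2 * real n)) *
       (1 / q ^ (2 * n - 2 * r + 2) + 1 / (1 - 1 / q ^ (2 * n + 1)) * (1 / q ^ (n + 1)))
     \<and>
     Q_prob n q r \<ge> (1 - 1 / q ^ n) * (1 - 1 / q) ^ 4 *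
       (1 / q ^ (2 * n - 2 * r + 2)
        - 1 / (q ^ (n + 1) * (1 - 1 / q))
        - 1 / (q ^ (2 * n - 2 * r + 3) * (1 - 1 / q)\<^sup>2)
        - 1 / (q ^ (3 * n - 3 * r + 4) * (1 - 1 / q) ^ 3)
        - 1 / (1 - 1 / q)\<^sup>2 * (1 / (q ^ (2 * n + 3) * (1 - 1 / q ^ (2 * n + 3)))))"
proof -
  define x where "x = 1 / q"
  have x: "0 < x" "x \<le> 1/2" "x < 1" using assms by (auto simp: x_def field_simps)
  have pow: "1 / q ^ k = x ^ k" for k by (simp add: x_def power_divide)
  have pow': "1 / (q ^ k * c) = x ^ k / c" for k c by (simp add: x_def power_divide)
  define b where "b = n + 1 - r"
  have b: "2 * n - 2 * r + 2 = 2 * b" "2 * n - 2 * r + 3 = 2 * b + 1"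
    using assms by (auto simp: b_def)
  show ?thesis
    unfolding pow pow' b unfolding x_def[symmetric]
  proof
    have "Q_prob n q r \<le> 1 / (1 - x) powr (1 + 4 * sqrt (2 * real n)) * x ^ (2 * b)"
      unfolding b_def using assms x_def by (intro Q_prob_le) auto
    also have "\<dots> \<le> 1 / (1 - x) powr (1 + 4 * sqrt (2 * real n)) *
        (x ^ (2 * b) + 1 / (1 - x ^ (2 * n + 1)) * x ^ (n + 1))"
      using x one_minus_power_pos[of x "2 * n + 1"] by (intro mult_left_mono) auto
    finally show "Q_prob n q r \<le> 1 / (1 - x) powr (1 + 4 * sqrt (2 * real n)) *
        (x ^ (2 * b) + 1 / (1 - x ^ (2 * n + 1)) * x ^ (n + 1))" .
  next
    let ?rest = "x ^ (3 * n - 3 * r + 4) / (1 - x) ^ 3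
        + 1 / (1 - x)\<^sup>2 * (x ^ (2 * n + 3) / (1 - x ^ (2 * n + 3)))"
    let ?br = "x ^ (2 * b) - x ^ (n + 1) / (1 - x) - x ^ (2 * b + 1) / (1 - x)\<^sup>2
        - x ^ (3 * n - 3 * r + 4) / (1 - x) ^ 3
        - 1 / (1 - x)\<^sup>2 * (x ^ (2 * n + 3) / (1 - x ^ (2 * n + 3)))"
    have rest: "0 \<le> ?rest"
      using x one_minus_power_pos[of x "2 * n + 3"] by (intro add_nonneg_nonneg mult_nonneg_nonneg) auto
    have pre: "0 \<le> (1 - x ^ n) * (1 - x) ^ 4"
      using x by (simp add: power_le_one)
    have t1: "0 \<le> x ^ (n + 1) / (1 - x)" and t2: "0 \<le> x ^ (2 * b + 1) / (1 - x)\<^sup>2" using x by auto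
    have split: "x ^ (2 * b) * (1 - x / (1 - x)\<^sup>2) = x ^ (2 * b) - x ^ (2 * b + 1) / (1 - x)\<^sup>2"
      by (simp add: right_diff_distrib mult.commute)
    \<comment> \<open>Only the first and third terms of the bracket are kept; the dropped ones are
      all subtracted and nonnegative.\<close>
    have br: "?br \<le> x ^ (2 * b) * (1 - x / (1 - x)\<^sup>2)"
      unfolding split using rest t1 by linarith
    show "(1 - x ^ n) * (1 - x) ^ 4 * ?br \<le> Q_prob n q r"
    proof (cases "n + 1 < 2 * r \<and> x < (1 - x)\<^sup>2")
      case True
      have "(1 - x ^ n) * (1 - x) ^ 4 * ?br \<le> (1 - x ^ n) * (1 - x) ^ 4 * (x ^ (2 * b) * (1 - x / (1 - x)\<^sup>2))"
        by (rule mult_left_mono[OF br pre])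
      also have "\<dots> = (1 - x ^ n) * ((1 - x)\<^sup>2 * ((1 - x)\<^sup>2 * (1 - x / (1 - x)\<^sup>2))) * x ^ (2 * b)"
        by (simp only: power4_eq_xxxx power2_eq_square mult_ac)
      also have "(1 - x)\<^sup>2 * (1 - x / (1 - x)\<^sup>2) = (1 - x)\<^sup>2 - x"
        using x by (simp add: right_diff_distrib)
      also have "(1 - x ^ n) * ((1 - x)\<^sup>2 * ((1 - x)\<^sup>2 - x)) * x ^ (2 * b) \<le> Q_prob n q r"
        unfolding b_def using True assms x_def by (intro Q_prob_ge) auto
      finally show ?thesis .
    next
      \<comment> \<open>The bound is trivial here: either 2r \<le> n + 1 and the second term of the
        bracket outweighs the first, or \<open>(1 - x)^2 \<le> x\<close> and the third one
        does.\<close>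
      case False
      have "?br \<le> 0"
      proof (cases "x < (1 - x)\<^sup>2")
        case True
        hence "n + 1 \<le> 2 * b" using False assms by (auto simp: b_def)
        hence "x ^ (2 * b) \<le> x ^ (n + 1)" using x by (intro power_decreasing) auto
        also have "\<dots> \<le> x ^ (n + 1) / (1 - x)"
          using x by (simp add: field_simps)
        finally show ?thesis using rest t2 by linarith
      next
        case False
        hence "1 - x / (1 - x)\<^sup>2 \<le> 0" using x by (simp add: field_simps)
        hence "x ^ (2 * b) * (1 - x / (1 - x)\<^sup>2) \<le> 0" using x by (simp add: mult_nonneg_nonpos)
        with br show ?thesis by linarith
      qed
      with pre have "(1 - x ^ n) * (1 - x) ^ 4 * ?br \<le> 0" by (rule mult_nonneg_nonpos)
      with Q_prob_nonneg[of n q r] show ?thesis by linarith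
    qed
  qed
qed

end
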